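(* Let $\mathscr{A}=(\mathscr{A},f,g)$ be a commutative Krasner $(m,n)$-hyperring with scalar identity $1_{\mathscr{A}}$, let $S$ be an $n$-ary multiplicative subset of $\mathscr{A}$ containing $1_{\mathscr{A}}$, and let $P,P_1,\dots,P_n$ be hyperideals of $\mathscr{A}$ such that $P\subseteq\bigcup_{j=1}^nP_j$ but no $P_j$ can be omitted from the union (that is, $P\nsubseteq\bigcup_{l\ne j}P_l$ for each $1\le j\le n$). If, for some $1\le t\le n$, $P_t$ is an $n$-ary $S$-hyperideal of $\mathscr{A}$ and $P_j\cap S\ne\varnothing$ for all $j\in\{1,\dots,n\}\setminus\{t\}$, then $P\subseteq P_t$.
   Context: Let $m,n\ge 2$. Notation: $p_i^j$ denotes the sequence $p_i,\dots,p_j$ (empty if $j<i$); $p^{(k)}$ denotes $p$ repeated $k$ times; for non-empty subsets, $f(P_1^m)=\bigcup\{f(p_1^m)\mid p_i\in P_i\}$ and similarly for $g$; singletons are identified with elements. A canonical $m$-ary hypergroup $(\mathscr{A},f)$ is a set with $f:\mathscr{A}^m\to\{\text{non-empty subsets of }\mathscr{A}\}$ such that: $f$ is associative ($f(p_1^{i-1},f(p_i^{m+i-1}),p_{m+i}^{2m-1})$ is independent of $i$) and invariant under permutations of its arguments; there is a unique $0$ with $f(p,0^{(m-1)})=\{p\}$ for all $p$; each $p$ has a unique $-p$ with $0\in f(p,-p,0^{(m-2)})$; and $p\in f(p_1^m)$ implies $p_i\in f(p,-p_1,\dots,-p_{i-1},-p_{i+1},\dots,-p_m)$ for each $i$. A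 commutative Krasner $(m,n)$-hyperring with scalar identity $1_{\mathscr{A}}$ is $(\mathscr{A},f,g)$ with $(\mathscr{A},f)$ a canonical $m$-ary hypergroup, $g:\mathscr{A}^n\to\mathscr{A}$ an associative operation invariant under permutations of its arguments, $g$ distributive over $f$ in each argument ($g(p_1^{i-1},f(q_1^m),p_{i+1}^n)=f(g(p_1^{i-1},q_1,p_{i+1}^n),\dots,g(p_1^{i-1},q_m,p_{i+1}^n))$), $g(0,p_2^n)=0$, and $g(p,1_{\mathscr{A}}^{(n-1)})=p$ for all $p$. A hyperideal is a non-empty $P\subseteq\mathscr{A}$ with $f(p_1^m)\subseteq P$ and $-p\in P$ for all $p,p_1,\dots,p_m\in P$, and $g(p_1^{i-1},P,p_{i+1}^n)\subseteq P$ for all $p_j\in\mathscr{A}$ and all $i$; it is proper if $P\ne\mathscr{A}$. An $n$-ary multiplicative subset is a non-empty $S\subseteq\mathscr{A}$ with $g(s_1^n)\in S$ for all $s_1,\dots,s_n\in S$. Given such $S$, an $n$-ary $S$-hyperideal is a proper hyperideal $P$ such that whenever $g(p_1^n)\in P$ with $p_1,\dots,p_n\in\mathscr{A}$ and $p_i\in S$ for some $i$, then $g(p_1^{i-1},1_{\mathscr{A}},p_{i+1}^n)\in P$. *)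

theory Defs
  imports "HOL-Library.Multiset"
begin

text \<open>Operations of arity \<open>k\<close> are functions on lists; only their values on lists of
  length \<open>k\<close> over the carrier \<open>A\<close> matter. Positions in a list are counted from \<open>0\<close>.\<close>

definition tuples :: "'a set \<Rightarrow> nat \<Rightarrow> 'a list set" where
  "tuples A k = {ps \<in> lists A. length ps = k}"

definition singletons :: "'a list \<Rightarrow> 'a set list" where
  "singletons ps = map (\<lambda>p. {p}) ps"

definition hyperop_ext :: "('a list \<Rightarrow> 'a set) \<Rightarrow> 'a set list \<Rightarrow> 'a set" where
  "hyperop_ext f Ps = \<Union>{f ps | ps. ps \<in> listset Ps}"

definition op_ext :: "('a list \<Rightarrow> 'a) \<Rightarrow> 'a set list \<Rightarrow> 'a set" where
  "op_ext g Ps = {g ps | ps. ps \<in> listset Ps}"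

definition is_hyper_zero :: "nat \<Rightarrow> 'a set \<Rightarrow> ('a list \<Rightarrow> 'a set) \<Rightarrow> 'a \<Rightarrow> bool" where
  "is_hyper_zero m A f z \<longleftrightarrow> z \<in> A \<and> (\<forall>p\<in>A. f (p # replicate (m - 1) z) = {p})"

definition hyper_zero :: "nat \<Rightarrow> 'a set \<Rightarrow> ('a list \<Rightarrow> 'a set) \<Rightarrow> 'a" where
  "hyper_zero m A f = (THE z. is_hyper_zero m A f z)"

definition is_hyper_neg :: "nat \<Rightarrow> 'a set \<Rightarrow> ('a list \<Rightarrow> 'a set) \<Rightarrow> 'a \<Rightarrow> 'a \<Rightarrow> bool" where
  "is_hyper_neg m A f p q \<longleftrightarrow>
     q \<in> A \<and> hyper_zero m A f \<in> f (p # q # replicate (m - 2) (hyper_zero m A f))"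

definition hyper_neg :: "nat \<Rightarrow> 'a set \<Rightarrow> ('a list \<Rightarrow> 'a set) \<Rightarrow> 'a \<Rightarrow> 'a" where
  "hyper_neg m A f p = (THE q. is_hyper_neg m A f p q)"

locale canonical_hypergroup =
  fixes m :: nat and A :: "'a set" and f :: "'a list \<Rightarrow> 'a set"
  assumes f_closed: "ps \<in> tuples A m \<Longrightarrow> f ps \<subseteq> A"
    and f_nonempty: "ps \<in> tuples A m \<Longrightarrow> f ps \<noteq> {}"
    and f_assoc: "\<lbrakk>ps \<in> tuples A (2 * m - 1); i < m; j < m\<rbrakk> \<Longrightarrow>
      hyperop_ext f (singletons (take i ps) @ [f (take m (drop i ps))] @ singletons (drop (m + i) ps)) =
      hyperop_ext f (singletons (take j ps) @ [f (take m (drop j ps))] @ singletons (drop (m + j) ps))"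
    and f_perm: "\<lbrakk>ps \<in> tuples A m; mset qs = mset ps\<rbrakk> \<Longrightarrow> f qs = f ps"
    and ex1_zero: "\<exists>!z. is_hyper_zero m A f z"
    and ex1_neg: "p \<in> A \<Longrightarrow> \<exists>!q. is_hyper_neg m A f p q"
    and reversible: "\<lbrakk>ps \<in> tuples A m; p \<in> f ps; i < m\<rbrakk> \<Longrightarrow>
      ps ! i \<in> f (p # map (hyper_neg m A f) (take i ps @ drop (Suc i) ps))"

locale comm_krasner_hyperring = canonical_hypergroup m A f
  for m n :: nat and A :: "'a set" and f :: "'a list \<Rightarrow> 'a set"
    and g :: "'a list \<Rightarrow> 'a" and e :: 'a +
  assumes g_closed: "ps \<in> tuples A n \<Longrightarrow> g ps \<in> A"
    and g_assoc: "\<lbrakk>ps \<in> tuples A (2 * n - 1); i < n; j < n\<rbrakk> \<Longrightarrow>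
      g (take i ps @ [g (take n (drop i ps))] @ drop (n + i) ps) =
      g (take j ps @ [g (take n (drop j ps))] @ drop (n + j) ps)"
    and g_perm: "\<lbrakk>ps \<in> tuples A n; mset qs = mset ps\<rbrakk> \<Longrightarrow> g qs = g ps"
    and distrib: "\<lbrakk>ps \<in> tuples A n; qs \<in> tuples A m; i < n\<rbrakk> \<Longrightarrow>
      op_ext g ((singletons ps)[i := f qs]) = f (map (\<lambda>q. g (ps[i := q])) qs)"
    and g_zero: "ps \<in> tuples A (n - 1) \<Longrightarrow> g (hyper_zero m A f # ps) = hyper_zero m A f"
    and identity_closed: "e \<in> A"
    and g_identity: "p \<in> A \<Longrightarrow> g (p # replicate (n - 1) e) = p"

definition hyperideal ::
  "nat \<Rightarrow> nat \<Rightarrow> 'a set \<Rightarrow> ('a list \<Rightarrow> 'a set) \<Rightarrow> ('a list \<Rightarrow> 'a) \<Rightarrow> 'a set \<Rightarrow> bool" where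
  "hyperideal m n A f g P \<longleftrightarrow>
     P \<subseteq> A \<and> P \<noteq> {} \<and>
     (\<forall>ps \<in> tuples P m. f ps \<subseteq> P) \<and>
     (\<forall>p\<in>P. hyper_neg m A f p \<in> P) \<and>
     (\<forall>ps \<in> tuples A n. \<forall>i<n. op_ext g ((singletons ps)[i := P]) \<subseteq> P)"

definition mult_subset :: "nat \<Rightarrow> 'a set \<Rightarrow> ('a list \<Rightarrow> 'a) \<Rightarrow> 'a set \<Rightarrow> bool" where
  "mult_subset n A g S \<longleftrightarrow> S \<subseteq> A \<and> S \<noteq> {} \<and> (\<forall>ss \<in> tuples S n. g ss \<in> S)"

definition S_hyperideal ::
  "nat \<Rightarrow> nat \<Rightarrow> 'a set \<Rightarrow> ('a list \<Rightarrow> 'a set) \<Rightarrow> ('a list \<Rightarrow> 'a) \<Rightarrow> 'a \<Rightarrow> 'a set \<Rightarrow> 'a set \<Rightarrow> bool" where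
  "S_hyperideal m n A f g e S P \<longleftrightarrow>
     hyperideal m n A f g P \<and> P \<noteq> A \<and>
     (\<forall>ps \<in> tuples A n. \<forall>i<n. g ps \<in> P \<and> ps ! i \<in> S \<longrightarrow> g (ps[i := e]) \<in> P)"

end

theory Submission
  imports Defs
begin

text \<open>Irredundancy of the cover makes \<open>P \<inter> (\<Inter>j\<noteq>t. Q j)\<close> a subset of \<open>Q t\<close>: if \<open>x \<in> P\<close> lies in
  \<open>Q t\<close> only and \<open>y\<close> lies in \<open>P\<close> and in every other \<open>Q j\<close>, then by reversibility an element of
  \<open>f (x, y, 0, \<dots>, 0)\<close> can only lie in \<open>Q t\<close>, and so \<open>y \<in> Q t\<close>. Given \<open>p \<in> P\<close> and
  \<open>s j \<in> Q j \<inter> S\<close> for \<open>j \<noteq> t\<close>, the product \<open>g\<close> of \<open>p\<close> with these \<open>n - 1\<close> elements lies in that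
  intersection, and the defining property of an \<open>S\<close>-hyperideal allows replacing each
  \<open>s j\<close> by the identity, leaving \<open>p \<in> Q t\<close>.\<close>

lemma listset_iff_list_all2: "ps \<in> listset Ps \<longleftrightarrow> list_all2 (\<in>) ps Ps"
proof (induction Ps arbitrary: ps)
  case (Cons P Ps)
  then show ?case by (cases ps) (auto simp: set_Cons_def)
qed auto

text \<open>Absorption in the form used below: \<open>hyperideal\<close> states it through
  \<open>op_ext\<close>, whereas the products that follow are taken of plain lists.\<close>

lemma hyperideal_g_mem:
  assumes "hyperideal m n A f g P" "ps \<in> tuples A n" "i < n" "ps ! i \<in> P"
  shows "g ps \<in> P"
proof -
  have "ps \<in> listset ((singletons ps)[i := P])"
    using assms(2-4)
    by (auto simp: listset_iff_list_all2 list_all2_conv_all_nth singletons_def tuples_def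
        nth_list_update)
  then have "g ps \<in> op_ext g ((singletons ps)[i := P])"
    by (auto simp: op_ext_def)
  then show ?thesis
    using assms unfolding hyperideal_def by blast
qed

context canonical_hypergroup
begin

lemma hyper_zero_closed: "hyper_zero m A f \<in> A"
  using theI'[OF ex1_zero] by (simp add: hyper_zero_def is_hyper_zero_def)

text \<open>Reversibility puts \<open>ps ! i\<close> into \<open>f\<close> of \<open>q\<close> and
  the negatives of the other entries, and all of these arguments lie in \<open>P\<close>.\<close>

lemma hyperideal_reversible:
  assumes P: "hyperideal m n A f g P" and ps: "ps \<in> tuples A m" and "q \<in> f ps" "q \<in> P"
    and "i < m" and others: "\<And>j. j < m \<Longrightarrow> j \<noteq> i \<Longrightarrow> ps ! j \<in> P"
  shows "ps ! i \<in> P"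
proof -
  let ?rs = "take i ps @ drop (Suc i) ps"
  have len: "length ps = m"
    using ps by (simp add: tuples_def)
  have "set ?rs \<subseteq> P"
    using others len \<open>i < m\<close> by (auto simp: in_set_conv_nth)
  moreover have "\<forall>p\<in>P. hyper_neg m A f p \<in> P"
    using P by (simp add: hyperideal_def)
  ultimately have "q # map (hyper_neg m A f) ?rs \<in> tuples P m"
    using len \<open>i < m\<close> \<open>q \<in> P\<close> by (simp add: tuples_def in_lists_conv_set subset_iff) blast
  then have "f (q # map (hyper_neg m A f) ?rs) \<subseteq> P"
    using P by (auto simp: hyperideal_def)
  then show ?thesis
    using reversible[OF ps \<open>q \<in> f ps\<close> \<open>i < m\<close>] by blast
qed

end

context comm_krasner_hyperring
begin

lemma zero_in_hyperideal:
  assumes "n \<ge> 2" and P: "hyperideal m n A f g P"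
  shows "hyper_zero m A f \<in> P"
proof -
  let ?z = "hyper_zero m A f"
  obtain x where x: "x \<in> P" "x \<in> A"
    using P by (auto simp: hyperideal_def)
  \<comment> \<open>The product of zero with \<open>x\<close> is zero by \<open>g_zero\<close> and
    lies in \<open>P\<close> by absorption at position 1.\<close>
  let ?rs = "x # replicate (n - 2) ?z"
  have rs: "?rs \<in> tuples A (n - 1)"
    using x hyper_zero_closed \<open>n \<ge> 2\<close> by (auto simp: tuples_def)
  then have "?z # ?rs \<in> tuples A n"
    using hyper_zero_closed \<open>n \<ge> 2\<close> by (auto simp: tuples_def)
  then have "g (?z # ?rs) \<in> P"
    using hyperideal_g_mem[OF P, of "?z # ?rs" 1] x \<open>n \<ge> 2\<close> by simp
  then show ?thesis
    using g_zero[OF rs] by simp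
qed

lemma irredundant_cover_Inter_subset:
  assumes m: "m \<ge> 2" and n: "n \<ge> 2" and P: "hyperideal m n A f g P"
    and Q: "\<And>j. j \<in> J \<Longrightarrow> hyperideal m n A f g (Q j)"
    and cover: "P \<subseteq> (\<Union>j\<in>J. Q j)" and t: "t \<in> J"
    and irredundant: "\<not> P \<subseteq> (\<Union>j\<in>J - {t}. Q j)"
  shows "P \<inter> (\<Inter>j\<in>J - {t}. Q j) \<subseteq> Q t"
proof
  fix y assume y: "y \<in> P \<inter> (\<Inter>j\<in>J - {t}. Q j)"
  obtain x where x: "x \<in> P" "\<And>j. j \<in> J - {t} \<Longrightarrow> x \<notin> Q j"
    using irredundant by blast
  then have xt: "x \<in> Q t"
    using cover by blast
  let ?z = "hyper_zero m A f"
  \<comment> \<open>Padding with zero, which lies in every hyperideal, turns \<open>f\<close> into a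
    binary sum.\<close>
  let ?ps = "x # y # replicate (m - 2) ?z"
  have psP: "?ps \<in> tuples P m"
    using x y m zero_in_hyperideal[OF n P] by (auto simp: tuples_def)
  then have ps: "?ps \<in> tuples A m"
    using P by (auto simp: tuples_def hyperideal_def)
  obtain q where q: "q \<in> f ?ps"
    using f_nonempty[OF ps] by blast
  have "q \<in> P"
    using P psP q unfolding hyperideal_def by blast
  \<comment> \<open>Otherwise reversibility at position 0 would force \<open>x\<close> into
    \<open>Q j\<close>.\<close>
  have "q \<notin> Q j" if j: "j \<in> J - {t}" for j
  proof
    assume "q \<in> Q j"
    have Qj: "hyperideal m n A f g (Q j)"
      using Q j by blast
    have "?ps ! k \<in> Q j" if "k < m" "k \<noteq> 0" for k
      using that y j zero_in_hyperideal[OF n Qj] by (auto simp: nth_Cons')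
    then have "?ps ! 0 \<in> Q j"
      using hyperideal_reversible[OF Qj ps q \<open>q \<in> Q j\<close>, of 0] m by simp
    then show False
      using x j by simp
  qed
  then have "q \<in> Q t"
    using cover \<open>q \<in> P\<close> by blast
  have "?ps ! k \<in> Q t" if "k < m" "k \<noteq> 1" for k
    using that xt zero_in_hyperideal[OF n Q[OF t]] by (auto simp: nth_Cons')
  then have "?ps ! 1 \<in> Q t"
    using hyperideal_reversible[OF Q[OF t] ps q \<open>q \<in> Q t\<close>, of 1] m by simp
  then show "y \<in> Q t"
    by simp
qed

text \<open>The entries of \<open>ss\<close> are replaced by \<open>e\<close> one at a time; once
  all are replaced, \<open>g_identity\<close> leaves \<open>p\<close>.\<close>

lemma S_hyperideal_cancel:
  assumes n: "n \<ge> 2" and P: "S_hyperideal m n A f g e S P" and "S \<subseteq> A"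
    and p: "p \<in> A" and ss: "ss \<in> tuples S (n - 1)" and mem: "g (p # ss) \<in> P"
  shows "p \<in> P"
proof -
  have "g (p # replicate k e @ drop k ss) \<in> P" if "k \<le> n - 1" for k
    using that
  proof (induction k)
    case 0
    then show ?case using mem by simp
  next
    case (Suc k)
    let ?ps = "p # replicate k e @ drop k ss"
    have len: "length ss = n - 1" and sub: "set ss \<subseteq> S"
      using ss by (auto simp: tuples_def)
    have k: "k < length ss"
      using Suc.prems len by simp
    have "?ps \<in> tuples A n"
      using p identity_closed \<open>S \<subseteq> A\<close> sub len k n
      by (auto simp: tuples_def dest!: in_set_dropD)
    moreover have "?ps ! Suc k \<in> S"
      using sub k by (auto simp: nth_append)
    \<comment> \<open>The first entry not yet replaced has index \<open>Suc k\<close>, since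
      \<open>p\<close> occupies position 0.\<close>
    ultimately have "g (?ps[Suc k := e]) \<in> P"
      using P Suc.IH Suc.prems k len unfolding S_hyperideal_def
      by (metis One_nat_def Suc_leD less_diff_conv Suc_eq_plus1)
    moreover have "?ps[Suc k := e] = p # replicate (Suc k) e @ drop (Suc k) ss"
      using Cons_nth_drop_Suc[OF k, symmetric]
      by (simp add: list_update_append replicate_app_Cons_same)
    ultimately show ?case by simp
  qed
  from this[of "n - 1"] show ?thesis
    using ss g_identity[OF p] by (simp add: tuples_def)
qed

end

theorem theorem3p19:
  fixes m n t :: nat
    and A S P :: "'a set" and Q :: "nat \<Rightarrow> 'a set"
    and f :: "'a list \<Rightarrow> 'a set" and g :: "'a list \<Rightarrow> 'a" and e :: 'a
  assumes "m \<ge> 2" and "n \<ge> 2"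
    and "comm_krasner_hyperring m n A f g e"
    and "mult_subset n A g S" and "e \<in> S"
    and "hyperideal m n A f g P"
    and "\<forall>j\<in>{1..n}. hyperideal m n A f g (Q j)"
    and "P \<subseteq> (\<Union>j\<in>{1..n}. Q j)"
    and "\<forall>j\<in>{1..n}. \<not> P \<subseteq> (\<Union>l\<in>{1..n} - {j}. Q l)"
    and "t \<in> {1..n}"
    and "S_hyperideal m n A f g e S (Q t)"
    and "\<forall>j\<in>{1..n} - {t}. Q j \<inter> S \<noteq> {}"
  shows "P \<subseteq> Q t"
proof
  interpret comm_krasner_hyperring m n A f g e by fact
  fix p assume p: "p \<in> P"
  have "S \<subseteq> A"
    using assms(4) by (simp add: mult_subset_def)
  have pA: "p \<in> A"
    using p assms(6) by (auto simp: hyperideal_def)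
  obtain s where s: "\<And>j. j \<in> {1..n} - {t} \<Longrightarrow> s j \<in> Q j \<inter> S"
    using bchoice[of "{1..n} - {t}" "\<lambda>j x. x \<in> Q j \<inter> S"] assms(12) by blast
  \<comment> \<open>Listing the \<open>n - 1\<close> indices other than \<open>t\<close> leaves
    exactly one argument of \<open>g\<close> for \<open>p\<close>.\<close>
  define js where "js = sorted_list_of_set ({1..n} - {t})"
  have js: "set js = {1..n} - {t}" "length js = n - 1"
    using \<open>t \<in> {1..n}\<close> by (auto simp: js_def)
  have "s j \<in> S" if "j \<in> set js" for j
    using s js that by blast
  then have ss: "map s js \<in> tuples S (n - 1)"
    using js(2) by (auto simp: tuples_def)
  then have ps: "p # map s js \<in> tuples A n"
    using pA \<open>S \<subseteq> A\<close> \<open>n \<ge> 2\<close> by (auto simp: tuples_def)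
  have "g (p # map s js) \<in> P"
    using hyperideal_g_mem[OF assms(6) ps, of 0] p \<open>n \<ge> 2\<close> by simp
  \<comment> \<open>The factor \<open>s j\<close> lies in \<open>Q j\<close>, so absorption at its
    position gives the claim.\<close>
  moreover have "g (p # map s js) \<in> Q j" if j: "j \<in> {1..n} - {t}" for j
  proof -
    obtain k where "k < length js" "js ! k = j"
      using j js by (metis in_set_conv_nth)
    then show ?thesis
      using hyperideal_g_mem[OF _ ps, of m f g "Q j" "Suc k"] assms(7) s[OF j] j js(2) by auto
  qed
  moreover have "P \<inter> (\<Inter>j\<in>{1..n} - {t}. Q j) \<subseteq> Q t"
    using assms by (intro irredundant_cover_Inter_subset) auto
  ultimately have "g (p # map s js) \<in> Q t"
    by blast
  then show "p \<in> Q t"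
    using S_hyperideal_cancel[OF \<open>n \<ge> 2\<close> assms(11) \<open>S \<subseteq> A\<close> pA ss] by blast
qed

end
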